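(* For every $L>0$ there exists a constant $C_L$ depending only on $L$ such that for all $Q>(6/L\lor12)$, all integers $N>\exp(3C_L)$ and all integers $T$ such that $T=0.5N^{\alpha}$ for some $\alpha\in(2/3+C_L/\log(N),1]$, if $a_i=i/N$ and $y_i\sim\mathrm{Bernoulli}(m(a_i))$ for $i\in\{1,\dots,N\}$, then $$\inf_{\phi}\ \sup_{m\in\mathcal F_{p,L,Q}}\ \mathbb P\left(R_T^{\phi}(m)\ge0.01\,T^{1/(3\alpha)}\right)\ge0.1,\qquad p=0.5N^{\alpha-1},$$ where the infimum is over all strategies $\phi$.
   Context: Finite continuum-armed bandit: there are $N$ arms with covariates $a_1,\dots,a_N\in[0,1]$ and a budget $T=pN$. Given a mean reward function $m:[0,1]\to[0,1]$, the rewards $y_1,\dots,y_N$ are independent with $\mathbb E[y_i]=m(a_i)$. A strategy $\phi$ chooses at each step $t=1,\dots,T$ an arm $\phi(t)\in\{1,\dots,N\}$ not pulled before, based on the past observations $(\phi(1),y_{\phi(1)},\dots,\phi(t-1),y_{\phi(t-1)})$ (and possibly independent randomization), without knowledge of $m$. Let $\phi^*$ be a permutation of $\{1,\dots,N\}$ with $m(a_{\phi^*(1)})\ge\dots\ge m(a_{\phi^*(N)})$. The regret is $R_T^\phi(m)=\sum_{t=1}^Tm(a_{\phi^*(t)})-\sum_{t=1}^Tm(a_{\phi(t)})$. With $\lambda$ the Lebesgue measure, for measurable $m$ and $p\in(0,1)$ let $M=\inf\{A:\lambda(\{x:m(x)\ge A\})<p\}$. $\mathcal F_{p,L,Q}$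 is the set of measurable functions $m:[0,1]\to[0,1]$ such that, for this $M$: (i) for all $(x,y)\in[0,1]^2$, $|m(x)-m(y)|\le\max\{|M-m(x)|,L|x-y|\}$; (ii) for all $\epsilon\in(0,1)$, $\lambda(\{x:|M-m(x)|\le\epsilon\})\le Q\epsilon$. $a\lor b=\max(a,b)$. *)

theory Defs
  imports "HOL-Probability.Probability"
begin

section \<open>The class of mean reward functions\<close>

text \<open>Functions on the unit interval are total functions on the reals whose values outside
  \<open>{0..1}\<close> are never used.\<close>

definition threshold :: "real \<Rightarrow> (real \<Rightarrow> real) \<Rightarrow> real" where
  "threshold p m = Inf {A. measure lborel {x \<in> {0..1}. A \<le> m x} < p}"

definition reward_class :: "real \<Rightarrow> real \<Rightarrow> real \<Rightarrow> (real \<Rightarrow> real) set" where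
  "reward_class p L Q = {m.
     m \<in> borel_measurable (restrict_space borel {0..1}) \<and>
     m \<in> {0..1} \<rightarrow> {0..1} \<and>
     (\<forall>x\<in>{0..1}. \<forall>y\<in>{0..1}.
        \<bar>m x - m y\<bar> \<le> max \<bar>threshold p m - m x\<bar> (L * \<bar>x - y\<bar>)) \<and>
     (\<forall>\<epsilon>\<in>{0<..<1}. measure lborel {x \<in> {0..1}. \<bar>threshold p m - m x\<bar> \<le> \<epsilon>} \<le> Q * \<epsilon>)}"


section \<open>Strategies\<close>

text \<open>A history lists the pairs (arm, observed reward) in chronological order; Bernoulli rewards
  are Booleans.\<close>

type_synonym history = "(nat \<times> bool) list"

definition admissible_history :: "nat \<Rightarrow> nat \<Rightarrow> history \<Rightarrow> bool" where
  "admissible_history N T h \<longleftrightarrow>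
     length h < T \<and> distinct (map fst h) \<and> fst ` set h \<subseteq> {1..N}"

text \<open>A randomized strategy is a pair \<open>(U, \<phi>)\<close>. A seed \<open>u\<close> with law \<open>U\<close>, where \<open>U\<close> is any
  probability measure on any sigma-algebra over the reals, is drawn independently of the rewards;
  after history \<open>h\<close> the next arm is \<open>\<phi> u h\<close>. Only finitely many histories are admissible, so
  real-valued seeds entail no loss of generality. The codomain \<open>{1..N} - fst ` set h\<close> below
  expresses that arms are never pulled twice.\<close>

definition strategies :: "nat \<Rightarrow> nat \<Rightarrow> (real measure \<times> (real \<Rightarrow> history \<Rightarrow> nat)) set" where
  "strategies N T = {(U, \<phi>). prob_space U \<and>
     (\<forall>h. admissible_history N T h \<longrightarrow>
        (\<lambda>u. \<phi> u h) \<in> U \<rightarrow>\<^sub>M count_space ({1..N} - fst ` set h))}"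

text \<open>The history after \<open>t\<close> steps, when pulling arm \<open>i\<close> yields \<open>y i\<close>.\<close>

primrec run :: "(history \<Rightarrow> nat) \<Rightarrow> (nat \<Rightarrow> bool) \<Rightarrow> nat \<Rightarrow> history" where
  "run f y 0 = []"
| "run f y (Suc t) = run f y t @ [(f (run f y t), y (f (run f y t)))]"

text \<open>The arm pulled at step \<open>t\<close>, for \<open>t = 1, 2, \<dots>\<close>\<close>

definition pulled_arm :: "(history \<Rightarrow> nat) \<Rightarrow> (nat \<Rightarrow> bool) \<Rightarrow> nat \<Rightarrow> nat" where
  "pulled_arm f y t = f (run f y (t - 1))"


section \<open>Regret\<close>

definition oracle_order :: "nat \<Rightarrow> (nat \<Rightarrow> real) \<Rightarrow> (real \<Rightarrow> real) \<Rightarrow> nat \<Rightarrow> nat" where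
  "oracle_order N a m =
     (SOME \<sigma>. \<sigma> permutes {1..N} \<and> antimono_on {1..N} (\<lambda>t. m (a (\<sigma> t))))"

lemma oracle_order_exists:
  fixes g :: "nat \<Rightarrow> real"
  shows "\<exists>\<sigma>. \<sigma> permutes {1..N} \<and> antimono_on {1..N} (\<lambda>t. g (\<sigma> t))"
proof -
  define xs where "xs = rev (sort_key g [1..<Suc N])"
  define \<sigma> where "\<sigma> = (\<lambda>t. if t \<in> {1..N} then xs ! (t - 1) else t)"
  have len: "length xs = N" and dist: "distinct xs" and st: "set xs = {1..N}"
    by (auto simp: xs_def)
  have bij: "bij_betw (\<lambda>t. xs ! (t - 1)) {1..N} {1..N}"
  proof -
    have "bij_betw (\<lambda>t::nat. t - 1) {1..N} {..<N}"
      by (rule bij_betwI[where g = Suc]) auto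
    moreover have "bij_betw ((!) xs) {..<N} {1..N}"
      using bij_betw_nth[OF dist] len st by auto
    ultimately show ?thesis using bij_betw_trans by (fastforce simp: o_def)
  qed
  have "\<sigma> permutes {1..N}"
  proof (rule bij_imp_permutes)
    show "bij_betw \<sigma> {1..N} {1..N}"
      using bij by (rule bij_betw_cong[THEN iffD1, rotated]) (simp add: \<sigma>_def)
  qed (auto simp: \<sigma>_def)
  moreover have "antimono_on {1..N} (\<lambda>t. g (\<sigma> t))"
  proof (rule monotone_onI)
    fix s t assume st: "s \<in> {1..N}" "t \<in> {1..N}" "s \<le> t"
    have "sorted (map g (rev xs))" by (simp add: xs_def)
    then have "sorted_wrt (\<ge>) (map g xs)"
      by (simp add: sorted_wrt_rev rev_map[symmetric])
    then have "g (xs ! (s-1)) \<ge> g (xs ! (t-1))"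
      using st len sorted_wrt_nth_less[of "(\<ge>)" "map g xs" "s-1" "t-1"]
      by (cases "s = t") auto
    then show "g (\<sigma> s) \<ge> g (\<sigma> t)" using st by (simp add: \<sigma>_def)
  qed
  ultimately show ?thesis by blast
qed

lemma oracle_order:
  shows oracle_order_permutes: "oracle_order N a m permutes {1..N}"
    and oracle_order_antimono: "antimono_on {1..N} (\<lambda>t. m (a (oracle_order N a m t)))"
  using someI_ex[OF oracle_order_exists[of N "\<lambda>i. m (a i)"]]
  by (simp_all add: oracle_order_def)

definition regret ::
  "nat \<Rightarrow> nat \<Rightarrow> (nat \<Rightarrow> real) \<Rightarrow> (real \<Rightarrow> real) \<Rightarrow> (history \<Rightarrow> nat) \<Rightarrow> (nat \<Rightarrow> bool) \<Rightarrow> real" where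
  "regret N T a m f y =
     (\<Sum>t=1..T. m (a (oracle_order N a m t))) - (\<Sum>t=1..T. m (a (pulled_arm f y t)))"


section \<open>The probability space\<close>

text \<open>Joint law of the seed and the independent rewards \<open>y\<^sub>i \<sim> Bernoulli(m(a\<^sub>i))\<close>, \<open>i = 1, \<dots>, N\<close>\<close>

definition bandit_space ::
  "nat \<Rightarrow> (nat \<Rightarrow> real) \<Rightarrow> (real \<Rightarrow> real) \<Rightarrow> real measure \<Rightarrow> (real \<times> (nat \<Rightarrow> bool)) measure" where
  "bandit_space N a m U =
     U \<Otimes>\<^sub>M measure_pmf (Pi_pmf {1..N} False (\<lambda>i. bernoulli_pmf (m (a i))))"

definition regret_tail ::
  "nat \<Rightarrow> nat \<Rightarrow> (nat \<Rightarrow> real) \<Rightarrow> (real \<Rightarrow> real) \<Rightarrow>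
   real measure \<times> (real \<Rightarrow> history \<Rightarrow> nat) \<Rightarrow> real \<Rightarrow> ennreal" where
  "regret_tail N T a m = (\<lambda>(U, \<phi>) r.
     emeasure (bandit_space N a m U)
       {(u, y) \<in> space (bandit_space N a m U). r \<le> regret N T a m (\<phi> u) y})"

end

theory Submission
  imports Defs
begin

text \<open>
  Le Cam's two-point method. Let \<open>l = min L (1/2)\<close> and let \<open>D\<close> be the distance to the three nodes
  \<open>p - w\<close>, \<open>p\<close>, \<open>p + w\<close>, where \<open>w\<close> is of order \<open>N powr (-1/3)\<close>. Both reward functions have the form
  \<open>1/2 \<plusminus> l D\<close>: one has the sign \<open>+\<close> exactly on \<open>(-\<infinity>, p]\<close>, the other exactly on
  \<open>(-\<infinity>, p - w] \<union> (p, p + w]\<close>. Both have threshold \<open>1/2\<close>, and \<open>{D \<le> \<epsilon>/l}\<close> has measure at most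
  \<open>6\<epsilon>/l \<le> Q\<epsilon>\<close>. The two functions disagree exactly about which arms in \<open>(p - w, p + w]\<close> are good, so
  whatever set of arms is pulled, every such arm is misclassified under one of them. Hence the two
  regrets add up to at least \<open>l \<Sum> D\<close> over these arms, and one of them is of order \<open>N powr (1/3)\<close>. On the other
  hand the Hellinger affinity of the two reward laws is bounded below by a constant, because the
  sum of \<open>(l D)\<^sup>2\<close> over these arms is of order \<open>N w\<^sup>3\<close>.
\<close>

section \<open>Two-point testing of product laws\<close>

text \<open>Le Cam's inequality. Split \<open>sqrt (P x * Q x)\<close> as
  \<open>sqrt (min) * sqrt (max)\<close> and apply Cauchy-Schwarz: the maxima sum to at most 2, and
  the minimum is at most \<open>P\<close> on \<open>A\<close> and at most \<open>Q\<close> off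
  \<open>A\<close>, where \<open>B\<close> must hold.\<close>

lemma pmf_two_point_bound:
  fixes P Q :: "'a pmf"
  assumes "finite X" "set_pmf P \<subseteq> X" "set_pmf Q \<subseteq> X" "A \<union> B = UNIV"
  shows "measure P A + measure Q B \<ge> (\<Sum>x\<in>X. sqrt (pmf P x * pmf Q x))\<^sup>2 / 2"
proof -
  let ?m = "\<lambda>x. min (pmf P x) (pmf Q x)" and ?M = "\<lambda>x. max (pmf P x) (pmf Q x)"
  have "(\<Sum>x\<in>X. sqrt (pmf P x * pmf Q x)) = (\<Sum>x\<in>X. sqrt (?m x) * sqrt (?M x))"
    by (intro sum.cong) (auto simp: min_def max_def real_sqrt_mult)
  then have "(\<Sum>x\<in>X. sqrt (pmf P x * pmf Q x))\<^sup>2 \<le> (\<Sum>x\<in>X. (sqrt (?m x))\<^sup>2) * (\<Sum>x\<in>X. (sqrt (?M x))\<^sup>2)"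
    using Cauchy_Schwarz_ineq_sum[of "\<lambda>x. sqrt (?m x)" "\<lambda>x. sqrt (?M x)" X] by simp
  also have "\<dots> = sum ?m X * sum ?M X"
    by (intro arg_cong2[of _ _ _ _ "(*)"] sum.cong) (auto simp: le_max_iff_disj)
  also have "\<dots> \<le> sum ?m X * 2"
  proof (rule mult_left_mono)
    have "sum ?M X \<le> (\<Sum>x\<in>X. pmf P x + pmf Q x)"
      by (intro sum_mono) auto
    then show "sum ?M X \<le> 2"
      using sum_pmf_eq_1[OF assms(1,2)] sum_pmf_eq_1[OF assms(1,3)] by (simp add: sum.distrib)
  qed (auto intro: sum_nonneg)
  also have "sum ?m X \<le> (\<Sum>x\<in>X \<inter> A. pmf P x) + (\<Sum>x\<in>X - A. pmf Q x)"
    unfolding sum.Int_Diff[OF assms(1), of ?m A] by (intro add_mono sum_mono) auto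
  also have "\<dots> \<le> measure P A + measure Q B"
  proof (rule add_mono)
    show "(\<Sum>x\<in>X \<inter> A. pmf P x) \<le> measure P A"
      using assms(1) by (subst measure_measure_pmf_finite[symmetric]) (auto intro!: measure_pmf.finite_measure_mono)
    show "(\<Sum>x\<in>X - A. pmf Q x) \<le> measure Q B"
      using assms(1,4) by (subst measure_measure_pmf_finite[symmetric]) (auto intro!: measure_pmf.finite_measure_mono)
  qed
  finally show ?thesis by simp
qed

lemma sqrt_prod: "sqrt (prod f A) = (\<Prod>x\<in>A. sqrt (f x))"
  by (induction A rule: infinite_finite_induct) (simp_all add: real_sqrt_mult)

text \<open>The Hellinger affinity is multiplicative over independent coordinates. Restriction to
  \<open>A\<close> identifies the functions with default \<open>d\<close> off \<open>A\<close> with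
  \<open>PiE A\<close>, where a sum of products is a product of sums.\<close>

lemma affinity_Pi_pmf:
  fixes P Q :: "'i \<Rightarrow> 'b :: finite pmf"
  assumes "finite A"
  shows "(\<Sum>y\<in>PiE_dflt A d (\<lambda>_. UNIV). sqrt (pmf (Pi_pmf A d P) y * pmf (Pi_pmf A d Q) y))
       = (\<Prod>i\<in>A. \<Sum>b\<in>UNIV. sqrt (pmf (P i) b * pmf (Q i) b))"
proof -
  have "inj_on (\<lambda>y. restrict y A) (PiE_dflt A d (\<lambda>_. UNIV))"
    by (force simp: inj_on_def PiE_dflt_def fun_eq_iff restrict_def)
  then have bij: "bij_betw (\<lambda>y. restrict y A) (PiE_dflt A d (\<lambda>_. UNIV)) (PiE A (\<lambda>_. UNIV :: 'b set))"
    by (simp add: bij_betw_def restrict_PiE_dflt)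
  have "sqrt (pmf (Pi_pmf A d P) y * pmf (Pi_pmf A d Q) y)
      = (\<Prod>i\<in>A. sqrt (pmf (P i) (restrict y A i) * pmf (Q i) (restrict y A i)))"
    if "y \<in> PiE_dflt A d (\<lambda>_. UNIV)" for y
    using that assms by (auto simp: PiE_dflt_def pmf_Pi' sqrt_prod prod.distrib[symmetric])
  then have "(\<Sum>y\<in>PiE_dflt A d (\<lambda>_. UNIV). sqrt (pmf (Pi_pmf A d P) y * pmf (Pi_pmf A d Q) y))
      = (\<Sum>g\<in>PiE A (\<lambda>_. UNIV). \<Prod>i\<in>A. sqrt (pmf (P i) (g i) * pmf (Q i) (g i)))"
    by (simp add: sum.reindex_bij_betw[OF bij, symmetric])
  then show ?thesis by (simp add: prod_sum_PiE[OF assms])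
qed

lemma bernoulli_affinity:
  assumes "0 \<le> a" "a \<le> 1" "0 \<le> b" "b \<le> 1"
  shows "(\<Sum>x\<in>UNIV. sqrt (pmf (bernoulli_pmf a) x * pmf (bernoulli_pmf b) x))
       = sqrt (a * b) + sqrt ((1 - a) * (1 - b))"
  using assms by (simp add: UNIV_bool)

section \<open>Regret and misclassified arms\<close>

text \<open>Compare with the level \<open>c\<close> of the last oracle arm: all oracle arms in
  \<open>J\<close> have value at least \<open>c\<close>, all others at most \<open>c\<close>. Since
  \<open>I\<close> and \<open>J\<close> have equal size, subtracting \<open>c\<close> from every
  term changes both sums alike.\<close>

lemma sum_le_sum_oracle:
  fixes v :: "nat \<Rightarrow> real"
  assumes "\<sigma> permutes {1..N}" "antimono_on {1..N} (\<lambda>t. v (\<sigma> t))" "I \<subseteq> {1..N}" "card I \<le> N"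
  shows "sum v I \<le> (\<Sum>t=1..card I. v (\<sigma> t))"
proof (cases "card I = 0")
  case True
  then show ?thesis using assms(3) finite_subset by fastforce
next
  case False
  define T where "T = card I"
  define J where "J = \<sigma> ` {1..T}"
  define c where "c = v (\<sigma> T)"
  have T: "T \<in> {1..N}" using False assms(4) by (auto simp: T_def)
  have finI: "finite I" using assms(3) finite_subset by blast
  have inj: "inj_on \<sigma> {1..T}" using permutes_inj[OF assms(1)] inj_on_subset by blast
  have cardJ: "card J = T" using card_image[OF inj] by (simp add: J_def)
  have finJ: "finite J" by (simp add: J_def)
  have onJ: "v i \<ge> c" if "i \<in> J" for i
    using that T assms(2) unfolding J_def c_def by (auto simp: monotone_on_def)
  have offJ: "v i \<le> c" if i: "i \<in> I - J" for i
  proof -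
    obtain t where t: "t \<in> {1..N}" "i = \<sigma> t"
      using i assms(3) permutes_image[OF assms(1)] by blast
    then have "t > T" using i by (auto simp: J_def not_less[symmetric])
    then show ?thesis using t T assms(2) unfolding c_def by (auto simp: monotone_on_def)
  qed
  have "(\<Sum>i\<in>I. v i - c) = (\<Sum>i\<in>I \<inter> J. v i - c) + (\<Sum>i\<in>I - J. v i - c)"
    using finI by (simp add: sum.Int_Diff)
  also have "\<dots> \<le> (\<Sum>i\<in>I \<inter> J. v i - c)"
    using offJ by (auto intro: sum_nonpos)
  also have "\<dots> \<le> (\<Sum>i\<in>J. v i - c)"
    using finJ onJ by (intro sum_mono2) auto
  finally have "sum v I \<le> sum v J" by (simp add: sum_subtractf cardJ T_def)
  also have "\<dots> = (\<Sum>t=1..T. v (\<sigma> t))" unfolding J_def by (simp only: sum.reindex[OF inj] o_def)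
  finally show ?thesis by (simp add: T_def)
qed

section \<open>Measurability of histories and distinctness of pulled arms\<close>

definition proper_history :: "nat \<Rightarrow> nat \<Rightarrow> history \<Rightarrow> bool" where
  "proper_history N t h \<longleftrightarrow> length h = t \<and> distinct (map fst h) \<and> fst ` set h \<subseteq> {1..N}"

text \<open>There are only countably many histories and arms, so it suffices to check each step for
  a fixed past and a fixed next arm. The codomain records in addition that arms never repeat, which
  \<open>strategies_proper_history\<close> extracts.\<close>

lemma measurable_run:
  assumes "(U, \<phi>) \<in> strategies N T" "t \<le> T"
  shows "(\<lambda>(u, y). run (\<phi> u) y t)
    \<in> U \<Otimes>\<^sub>M measure_pmf Q \<rightarrow>\<^sub>M count_space (Collect (proper_history N t))"
  using assms(2)
proof (induction t)
  case 0
  then show ?case by (auto simp: proper_history_def)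
next
  case (Suc t)
  let ?M = "U \<Otimes>\<^sub>M measure_pmf Q"
  have IH: "(\<lambda>(u, y). run (\<phi> u) y t) \<in> ?M \<rightarrow>\<^sub>M count_space (Collect (proper_history N t))"
    using Suc by simp
  have step: "(\<lambda>(u, y). h @ [(\<phi> u h, y (\<phi> u h))])
      \<in> ?M \<rightarrow>\<^sub>M count_space (Collect (proper_history N (Suc t)))"
    if h: "proper_history N t h" for h
  proof -
    have phi: "(\<lambda>u. \<phi> u h) \<in> U \<rightarrow>\<^sub>M count_space ({1..N} - fst ` set h)"
      using assms(1) h Suc.prems by (auto simp: strategies_def admissible_history_def proper_history_def)
    have ext: "(\<lambda>x. h @ [(i, snd x i)]) \<in> ?M \<rightarrow>\<^sub>M count_space (Collect (proper_history N (Suc t)))"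
      if "i \<in> {1..N} - fst ` set h" for i
    proof -
      have "(\<lambda>y. h @ [(i, y i)]) \<in> measure_pmf Q \<rightarrow>\<^sub>M count_space (Collect (proper_history N (Suc t)))"
        using h that by (auto simp: proper_history_def)
      then show ?thesis by (rule measurable_compose[OF measurable_snd])
    qed
    have "(\<lambda>x. h @ [(\<phi> (fst x) h, snd x (\<phi> (fst x) h))])
        \<in> ?M \<rightarrow>\<^sub>M count_space (Collect (proper_history N (Suc t)))"
      by (rule measurable_compose_countable'[where f = "\<lambda>i x. h @ [(i, snd x i)]"
            and g = "\<lambda>x. \<phi> (fst x) h", OF ext measurable_compose[OF measurable_fst phi]]) auto
    then show ?thesis by (simp add: case_prod_beta)
  qed
  show ?case
    using measurable_compose_countable'[where f = "\<lambda>h (u, y). h @ [(\<phi> u h, y (\<phi> u h))]", OF _ IH] step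
    by (simp add: case_prod_beta)
qed

lemma fst_set_run: "fst ` set (run f y t) = pulled_arm f y ` {1..t}"
  by (induction t) (auto simp: pulled_arm_def atLeastAtMostSuc_conv)

lemma pulled_arm_inj:
  assumes "proper_history N T (run f y T)"
  shows "inj_on (pulled_arm f y) {1..T}"
proof -
  have "card (fst ` set (run f y T)) = T"
    using assms distinct_card[of "map fst (run f y T)"] by (auto simp: proper_history_def)
  then show ?thesis by (simp add: fst_set_run eq_card_imp_inj_on)
qed

lemma sum_pulled_arm_run: "(\<Sum>t=1..T. g (pulled_arm f y t)) = (\<Sum>x\<leftarrow>run f y T. g (fst x))"
  by (induction T) (simp_all add: pulled_arm_def)

text \<open>With \<open>P\<close> the set of pulled arms, the regret is at least the sum over
  \<open>I\<close> minus the sum over \<open>P\<close>. As both sets have \<open>T\<close> elements,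
  \<open>c\<close> may be subtracted throughout; common arms cancel, and each arm of the symmetric
  difference contributes its distance from \<open>c\<close>.\<close>

lemma regret_ge_misclassified:
  assumes "proper_history N T (run f y T)" "T \<le> N" "I \<subseteq> {1..N}" "card I = T"
    and "\<And>i. i \<in> I \<Longrightarrow> c \<le> m (a i)" "\<And>i. i \<in> {1..N} - I \<Longrightarrow> m (a i) \<le> c"
    and "A \<subseteq> {1..N}"
  shows "(\<Sum>i | i \<in> A \<and> (i \<in> I) \<noteq> (i \<in> pulled_arm f y ` {1..T}). \<bar>m (a i) - c\<bar>)
       \<le> regret N T a m f y"
proof -
  define P where "P = pulled_arm f y ` {1..T}"
  define v where "v i = m (a i) - c" for i
  have inj: "inj_on (pulled_arm f y) {1..T}" by (rule pulled_arm_inj[OF assms(1)])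
  have P: "finite P" "card P = T" "P \<subseteq> {1..N}"
    using card_image[OF inj] assms(1) fst_set_run[of f y T] by (auto simp: P_def proper_history_def)
  have I: "finite I" using assms(3) finite_subset by blast
  have sgn: "v i \<ge> 0" if "i \<in> I" for i using assms(5) that by (simp add: v_def)
  have sgn': "v i \<le> 0" if "i \<in> P - I" for i using assms(6) P(3) that by (force simp: v_def)
  have "(\<Sum>i | i \<in> A \<and> (i \<in> I) \<noteq> (i \<in> P). \<bar>v i\<bar>) \<le> (\<Sum>i\<in>(I - P) \<union> (P - I). \<bar>v i\<bar>)"
    using I P by (intro sum_mono2) auto
  also have "\<dots> = (\<Sum>i\<in>I - P. \<bar>v i\<bar>) + (\<Sum>i\<in>P - I. \<bar>v i\<bar>)"
    using I P by (intro sum.union_disjoint) auto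
  also have "\<dots> = (\<Sum>i\<in>I - P. v i) - (\<Sum>i\<in>P - I. v i)"
    using sgn sgn' by (simp add: sum_negf[symmetric])
  also have "\<dots> = sum v I - sum v P"
    using I P sum.Int_Diff[of I v P] sum.Int_Diff[of P v I] by (simp add: Int_commute)
  also have "\<dots> = (\<Sum>i\<in>I. m (a i)) - (\<Sum>i\<in>P. m (a i))"
    using assms(4) P by (simp add: v_def sum_subtractf)
  also have "(\<Sum>i\<in>I. m (a i)) \<le> (\<Sum>t=1..T. m (a (oracle_order N a m t)))"
    using sum_le_sum_oracle[OF oracle_order_permutes, of N "\<lambda>i. m (a i)" a m I]
      oracle_order_antimono[of N m a] assms(2-4) by simp
  also have "(\<Sum>i\<in>P. m (a i)) = (\<Sum>t=1..T. m (a (pulled_arm f y t)))"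
    unfolding P_def by (simp only: sum.reindex[OF inj] o_def)
  finally show ?thesis by (simp add: P_def v_def regret_def)
qed

text \<open>The regret depends on seed and rewards only through the final history, so the event is
  the preimage of a set of histories.\<close>

lemma sets_regret_ge:
  assumes "(U, \<phi>) \<in> strategies N T"
  shows "{(u, y) \<in> space (bandit_space N a m U). r \<le> regret N T a m' (\<phi> u) y}
    \<in> sets (bandit_space N a m U)"
proof -
  let ?M = "bandit_space N a m U"
  define g where "g h = (\<Sum>t=1..T. m' (a (oracle_order N a m' t))) - (\<Sum>x\<leftarrow>h. m' (a (fst x)))"
    for h :: history
  have "(\<lambda>(u, y). run (\<phi> u) y T) \<in> ?M \<rightarrow>\<^sub>M count_space (Collect (proper_history N T))"
    unfolding bandit_space_def by (rule measurable_run[OF assms]) simp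
  from measurable_sets[OF this, of "{h. proper_history N T h \<and> r \<le> g h}"] measurable_space[OF this]
  have "(\<lambda>(u, y). run (\<phi> u) y T) -` {h. proper_history N T h \<and> r \<le> g h} \<inter> space ?M \<in> sets ?M"
    and "\<And>u y. (u, y) \<in> space ?M \<Longrightarrow> proper_history N T (run (\<phi> u) y T)"
    by auto
  moreover have "regret N T a m' (\<phi> u) y = g (run (\<phi> u) y T)" for u y
    unfolding regret_def g_def using sum_pulled_arm_run[of "\<lambda>i. m' (a i)"] by simp
  ultimately show ?thesis
    by (elim back_subst[where P = "\<lambda>X. X \<in> sets ?M"]) auto
qed

lemma strategies_proper_history:
  assumes "(U, \<phi>) \<in> strategies N T" "u \<in> space U"
  shows "proper_history N T (run (\<phi> u) y T)"
  \<comment> \<open>The space of a pmf is the whole type, so any law of the rewards would do; a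
    point mass is a convenient instance.\<close>
  using measurable_space[OF measurable_run[OF assms(1) order_refl, of "return_pmf y"], of "(u, y)"]
    assms(2) by (simp add: space_pair_measure)

text \<open>For a fixed seed the strategy is deterministic and the two tail events are sets of
  reward vectors covering everything, so \<open>pmf_two_point_bound\<close> applies. The resulting
  bound does not depend on the seed and survives integration over it.\<close>

lemma bandit_two_point_bound:
  fixes c :: real
  assumes S: "(U, \<phi>) \<in> strategies N T"
    and cover: "\<And>u y. u \<in> space U \<Longrightarrow> r \<le> regret N T a m (\<phi> u) y \<or> r \<le> regret N T a m' (\<phi> u) y"
    and aff: "c \<le> (\<Prod>i\<in>{1..N}. \<Sum>b\<in>UNIV.
      sqrt (pmf (bernoulli_pmf (m (a i))) b * pmf (bernoulli_pmf (m' (a i))) b))\<^sup>2 / 2"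
  shows "ennreal c \<le> regret_tail N T a m (U, \<phi>) r + regret_tail N T a m' (U, \<phi>) r"
proof -
  let ?P = "\<lambda>m. Pi_pmf {1..N} False (\<lambda>i. bernoulli_pmf (m (a i)))"
  let ?X = "\<lambda>m. {(u, y) \<in> space (bandit_space N a m U). r \<le> regret N T a m (\<phi> u) y}"
  let ?Y = "\<lambda>m u. {y. r \<le> regret N T a m (\<phi> u) y}"
  interpret prob_space U using S by (simp add: strategies_def)
  have tail: "regret_tail N T a m (U, \<phi>) r = (\<integral>\<^sup>+u. emeasure (?P m) (?Y m u) \<partial>U)"
    and meas: "(\<lambda>u. emeasure (?P m) (?Y m u)) \<in> borel_measurable U" for m
  proof -
    have X: "?X m \<in> sets (U \<Otimes>\<^sub>M measure_pmf (?P m))"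
      using sets_regret_ge[OF S, of a m r m] by (simp add: bandit_space_def del: One_nat_def)
    have slice: "Pair u -` ?X m = ?Y m u" if "u \<in> space U" for u
      using that by (auto simp: bandit_space_def space_pair_measure)
    have "regret_tail N T a m (U, \<phi>) r = emeasure (U \<Otimes>\<^sub>M measure_pmf (?P m)) (?X m)"
      by (simp add: regret_tail_def bandit_space_def)
    also have "\<dots> = (\<integral>\<^sup>+u. emeasure (?P m) (Pair u -` ?X m) \<partial>U)"
      by (rule measure_pmf.emeasure_pair_measure_alt[OF X])
    finally show "regret_tail N T a m (U, \<phi>) r = (\<integral>\<^sup>+u. emeasure (?P m) (?Y m u) \<partial>U)"
      using slice by (simp cong: nn_integral_cong)
    show "(\<lambda>u. emeasure (?P m) (?Y m u)) \<in> borel_measurable U"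
      using measure_pmf.measurable_emeasure_Pair[OF X] slice by (simp cong: measurable_cong)
  qed
  have "ennreal c = (\<integral>\<^sup>+u. ennreal c \<partial>U)" by (simp add: emeasure_space_1)
  also have "\<dots> \<le> (\<integral>\<^sup>+u. emeasure (?P m) (?Y m u) + emeasure (?P m') (?Y m' u) \<partial>U)"
  proof (rule nn_integral_mono)
    fix u assume "u \<in> space U"
    then have "?Y m u \<union> ?Y m' u = UNIV" using cover by auto
    \<comment> \<open>Rewards are \<open>False\<close> outside \<open>{1..N}\<close>, so both laws
      live on one finite set.\<close>
    moreover have "set_pmf (?P m) \<subseteq> PiE_dflt {1..N} False (\<lambda>_. UNIV)" for m
      using set_Pi_pmf_subset[of "{1..N}" False "\<lambda>i. bernoulli_pmf (m (a i))"]
      by (auto simp: PiE_dflt_def)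
    ultimately have "c \<le> measure (?P m) (?Y m u) + measure (?P m') (?Y m' u)"
      using aff pmf_two_point_bound[of "PiE_dflt {1..N} False (\<lambda>_. UNIV)" "?P m" "?P m'"
          "?Y m u" "?Y m' u"] finite_PiE_dflt[of "{1..N}" "\<lambda>_. UNIV :: bool set" False]
      by (simp add: affinity_Pi_pmf)
    then show "ennreal c \<le> emeasure (?P m) (?Y m u) + emeasure (?P m') (?Y m' u)"
      by (simp add: measure_pmf.emeasure_eq_measure ennreal_plus[symmetric] ennreal_leI del: ennreal_plus)
  qed
  also have "\<dots> = regret_tail N T a m (U, \<phi>) r + regret_tail N T a m' (U, \<phi>) r"
    unfolding tail by (rule nn_integral_add[OF meas meas])
  finally show ?thesis .
qed

section \<open>The two reward functions\<close>

definition node_dist :: "real \<Rightarrow> real \<Rightarrow> real \<Rightarrow> real" where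
  "node_dist p w x = min \<bar>x - (p - w)\<bar> (min \<bar>x - p\<bar> \<bar>x - (p + w)\<bar>)"

definition bump :: "real \<Rightarrow> real \<Rightarrow> real \<Rightarrow> real set \<Rightarrow> real \<Rightarrow> real" where
  "bump l p w S x = 1 / 2 + (if x \<in> S then l else - l) * node_dist p w x"

lemma node_dist_nonneg: "0 \<le> node_dist p w x"
  by (simp add: node_dist_def)

lemma node_dist_triangle: "node_dist p w x \<le> node_dist p w y + \<bar>x - y\<bar>"
  unfolding node_dist_def by (simp add: min_def abs_if)

lemma node_dist_le: "z \<in> {p - w, p, p + w} \<Longrightarrow> node_dist p w x \<le> \<bar>x - z\<bar>"
  by (auto simp: node_dist_def)

lemma node_dist_le_iff:
  "node_dist p w x \<le> d \<longleftrightarrow> x \<in> {p - w - d..p - w + d} \<union> {p - d..p + d} \<union> {p + w - d..p + w + d}"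
  by (auto simp: node_dist_def min_le_iff_disj abs_le_iff)

lemma measurable_node_dist [measurable]: "node_dist p w \<in> borel_measurable borel"
  unfolding node_dist_def by measurable

text \<open>Rescaling by the number of arms moves the nodes to integers, where sums over arms can be
  computed exactly.\<close>

lemma node_dist_divide:
  assumes "0 < n"
  shows "node_dist (p / n) (w / n) (x / n) = node_dist p w x / n"
proof -
  have "\<bar>x / n - y / n\<bar> = \<bar>x - y\<bar> / n" for y
    using assms by (simp add: diff_divide_distrib[symmetric])
  moreover have "p / n - w / n = (p - w) / n" "p / n + w / n = (p + w) / n"
    by (simp_all add: diff_divide_distrib add_divide_distrib)
  ultimately show ?thesis
    using assms by (simp only: node_dist_def min_divide_distrib_right less_imp_le if_True)
qed

section \<open>Lebesgue measure estimates and membership in the reward class\<close>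

lemma fmeasurable_Icc: "{a..b::real} \<in> fmeasurable lborel"
  by (rule fmeasurableI) (simp_all add: emeasure_lborel_Icc_eq)

lemma fmeasurable_unit: "X \<in> sets borel \<Longrightarrow> X \<subseteq> {0..1::real} \<Longrightarrow> X \<in> fmeasurable lborel"
  using fmeasurableI2[OF fmeasurable_Icc] by simp

lemma measure_unit_le_1:
  assumes "X \<in> sets borel" "X \<subseteq> {0..1::real}"
  shows "measure lborel X \<le> 1"
  using measure_mono_fmeasurable[of X "{0..1}" lborel] assms fmeasurable_Icc by simp

lemma measure_node_dist_le:
  assumes "0 \<le> d"
  shows "measure lborel {x \<in> {0..1}. node_dist p w x \<le> d} \<le> 6 * d"
proof -
  let ?I = "\<lambda>z. {z - d..z + d}"
  have fm: "?I z \<in> fmeasurable lborel" for z by (rule fmeasurable_Icc)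
  have "measure lborel {x \<in> {0..1}. node_dist p w x \<le> d} \<le> measure lborel (?I (p - w) \<union> ?I p \<union> ?I (p + w))"
    by (rule measure_mono_fmeasurable) (auto simp: node_dist_le_iff intro!: fmeasurable.Un fm)
  also have "\<dots> \<le> measure lborel (?I (p - w) \<union> ?I p) + measure lborel (?I (p + w))"
    by (rule measure_Un_le) auto
  also have "measure lborel (?I (p - w) \<union> ?I p) \<le> measure lborel (?I (p - w)) + measure lborel (?I p)"
    by (rule measure_Un_le) auto
  finally show ?thesis using assms by simp
qed

lemma measurable_bump:
  assumes [measurable]: "S \<in> sets borel"
  shows "bump l p w S \<in> borel_measurable borel"
  unfolding bump_def by measurable

lemma abs_bump: "0 \<le> l \<Longrightarrow> \<bar>bump l p w S x - 1 / 2\<bar> = l * node_dist p w x"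
  using node_dist_nonneg[of p w x] by (simp add: bump_def abs_mult)

text \<open>With equal signs this is the Lipschitz property of the distance. With opposite signs a
  node \<open>z\<close> separates \<open>x\<close> and \<open>y\<close>, and the two distances to
  the nodes add up to at most the length of the path through \<open>z\<close>.\<close>

lemma bump_lipschitz:
  assumes "0 \<le> l"
    and cross: "\<And>x y. x \<in> S \<Longrightarrow> y \<notin> S \<Longrightarrow> \<exists>z\<in>{p - w, p, p + w}. min x y \<le> z \<and> z \<le> max x y"
  shows "\<bar>bump l p w S x - bump l p w S y\<bar> \<le> l * \<bar>x - y\<bar>"
proof (cases "(x \<in> S) = (y \<in> S)")
  case True
  have "\<bar>node_dist p w x - node_dist p w y\<bar> \<le> \<bar>x - y\<bar>"
    using node_dist_triangle[of p w x y] node_dist_triangle[of p w y x] by linarith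
  then have "l * \<bar>node_dist p w x - node_dist p w y\<bar> \<le> l * \<bar>x - y\<bar>"
    using assms(1) by (rule mult_left_mono)
  moreover have "bump l p w S x - bump l p w S y
      = (if x \<in> S then l else - l) * (node_dist p w x - node_dist p w y)"
    using True by (simp add: bump_def right_diff_distrib)
  then have "\<bar>bump l p w S x - bump l p w S y\<bar> = l * \<bar>node_dist p w x - node_dist p w y\<bar>"
    using assms(1) by (simp add: abs_mult)
  ultimately show ?thesis by simp
next
  case False
  then obtain z where z: "z \<in> {p - w, p, p + w}" "min x y \<le> z" "z \<le> max x y"
    using cross[of x y] cross[of y x] by (metis max.commute min.commute)
  then have "node_dist p w x + node_dist p w y \<le> \<bar>x - y\<bar>"
    using node_dist_le[OF z(1), of x] node_dist_le[OF z(1), of y] by linarith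
  then have "l * node_dist p w x + l * node_dist p w y \<le> l * \<bar>x - y\<bar>"
    using mult_left_mono[OF _ assms(1)] by (metis distrib_left)
  then show ?thesis
    using abs_bump[OF assms(1), of p w S x] abs_bump[OF assms(1), of p w S y] by linarith
qed

text \<open>For \<open>A\<close> at most 1/2 the superlevel set contains \<open>S\<close> within the
  unit interval, which has measure \<open>p\<close>. For larger \<open>A\<close> it lies in that set
  and misses an interval of positive length to the left of the node \<open>p - w\<close>, so its
  measure is below \<open>p\<close>.\<close>

lemma threshold_bump:
  assumes l: "0 < l" and w: "0 < w" "w < p" and S: "S \<in> sets borel"
    and meas: "measure lborel (S \<inter> {0..1}) = p" and sub: "{..p - w} \<subseteq> S"
  shows "threshold p (bump l p w S) = 1 / 2"
proof -
  let ?G = "\<lambda>A. {x \<in> {0..1}. A \<le> bump l p w S x}"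
  have G: "?G A \<in> sets borel" for A
  proof -
    have "{0..1} \<inter> (bump l p w S -` {A..} \<inter> space borel) \<in> sets borel"
      by (intro sets.Int measurable_sets[OF measurable_bump[OF S]]) auto
    also have "{0..1} \<inter> (bump l p w S -` {A..} \<inter> space borel) = ?G A" by auto
    finally show ?thesis .
  qed
  have fm: "?G A \<in> fmeasurable lborel" "S \<inter> {0..1} \<in> fmeasurable lborel" for A
    using G S by (auto intro!: fmeasurable_unit)
  have nd: "0 \<le> l * node_dist p w x" for x using l node_dist_nonneg[of p w x] by simp
  have "p \<le> 1"
    using measure_unit_le_1[of "S \<inter> {0..1}"] S meas by simp
  have "measure lborel (?G A) < p \<longleftrightarrow> 1 / 2 < A" for A
  proof (cases "1 / 2 < A")
    case True
    \<comment> \<open>Here \<open>l * d\<close> is half of \<open>A - 1 / 2\<close>, so the function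
      stays below \<open>A\<close> within distance \<open>d\<close> of the node; \<open>c\<close>
      truncates that interval at 0.\<close>
    define d where "d = (A - 1 / 2) / (2 * l)"
    define c where "c = max 0 (p - w - d)"
    have d: "0 < d" and ld: "l * d < A - 1 / 2" using True l by (auto simp: d_def)
    have c: "0 \<le> c" "c < p - w" "p - w - d \<le> c" using d w by (auto simp: c_def)
    have "?G A \<subseteq> (S \<inter> {0..1}) - {c..p - w}"
    proof (intro subsetI DiffI)
      fix x assume x: "x \<in> ?G A"
      then have big: "A - 1 / 2 \<le> (if x \<in> S then l else - l) * node_dist p w x" by (auto simp: bump_def)
      then show "x \<in> S \<inter> {0..1}" using x True nd[of x] by (auto split: if_splits)
      show "x \<notin> {c..p - w}"
      proof
        assume "x \<in> {c..p - w}"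
        then have "node_dist p w x \<le> d" using node_dist_le[of "p - w" p w x] c by auto
        then have "l * node_dist p w x \<le> l * d" using l by simp
        then show False using big ld nd[of x] True by (auto split: if_splits)
      qed
    qed
    then have "measure lborel (?G A) \<le> measure lborel ((S \<inter> {0..1}) - {c..p - w})"
      using G by (intro measure_mono_fmeasurable fmeasurable_Diff fm) auto
    also have "\<dots> = p - (p - w - c)"
      using c w sub \<open>p \<le> 1\<close> fm(2) meas by (subst measurable_measure_Diff) auto
    finally show ?thesis using True c by simp
  next
    case False
    have "S \<inter> {0..1} \<subseteq> ?G A"
    proof
      fix x assume "x \<in> S \<inter> {0..1}"
      then show "x \<in> ?G A" using False nd[of x] by (auto simp: bump_def)
    qed
    then have "p \<le> measure lborel (?G A)"
      using measure_mono_fmeasurable[OF _ _ fm(1), of "S \<inter> {0..1}" A] S meas by simp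
    then show ?thesis using False by simp
  qed
  then have "threshold p (bump l p w S) = Inf {1 / 2<..}"
    by (simp only: threshold_def greaterThan_def)
  then show ?thesis by simp
qed

lemma bump_in_reward_class:
  assumes l: "0 < l" "l \<le> 1 / 2" "l \<le> L" "6 / l \<le> Q" and w: "0 < w" "w < p" and S: "S \<in> sets borel"
    and meas: "measure lborel (S \<inter> {0..1}) = p" and sub: "{..p - w} \<subseteq> S"
    and cross: "\<And>x y. x \<in> S \<Longrightarrow> y \<notin> S \<Longrightarrow> \<exists>z\<in>{p - w, p, p + w}. min x y \<le> z \<and> z \<le> max x y"
  shows "bump l p w S \<in> reward_class p L Q"
proof -
  have thr: "threshold p (bump l p w S) = 1 / 2"
    by (rule threshold_bump) fact+
  have "p \<le> 1"
    using measure_unit_le_1[of "S \<inter> {0..1}"] S meas by simp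
  have "bump l p w S x \<in> {0..1}" if "x \<in> {0..1}" for x
  proof -
    \<comment> \<open>The middle node \<open>p\<close> lies in the unit interval, so the distance is
      at most 1 and \<open>l\<close> at most 1/2 keeps the values between 0 and 1.\<close>
    have "node_dist p w x \<le> 1" using node_dist_le[of p p w x] that w \<open>p \<le> 1\<close> by (auto simp: abs_le_iff)
    then have "l * node_dist p w x \<le> 1 / 2"
      using l node_dist_nonneg[of p w x] mult_mono[of l "1/2" "node_dist p w x" 1] by simp
    then show ?thesis using abs_bump[of l p w S x] l by (auto simp: abs_le_iff abs_if split: if_splits)
  qed
  moreover have "\<bar>bump l p w S x - bump l p w S y\<bar> \<le> L * \<bar>x - y\<bar>" for x y
  proof -
    \<comment> \<open>Condition (i) is met through its Lipschitz branch everywhere.\<close>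
    have "l * \<bar>x - y\<bar> \<le> L * \<bar>x - y\<bar>" using l by (intro mult_right_mono) auto
    with bump_lipschitz[of l S p w x y] show ?thesis using l cross by fastforce
  qed
  moreover have "measure lborel {x \<in> {0..1}. \<bar>1 / 2 - bump l p w S x\<bar> \<le> \<epsilon>} \<le> Q * \<epsilon>" if "0 < \<epsilon>" for \<epsilon>
  proof -
    have "{x \<in> {0..1}. \<bar>1 / 2 - bump l p w S x\<bar> \<le> \<epsilon>} = {x \<in> {0..1}. node_dist p w x \<le> \<epsilon> / l}"
      using l abs_bump[of l p w S] by (simp add: abs_minus_commute field_simps)
    also have "measure lborel \<dots> \<le> 6 * (\<epsilon> / l)"
      using that l by (intro measure_node_dist_le) simp
    also have "\<dots> = 6 / l * \<epsilon>" by simp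
    also have "\<dots> \<le> Q * \<epsilon>" using that l by (intro mult_right_mono) auto
    finally show ?thesis .
  qed
  moreover have "bump l p w S \<in> borel_measurable (restrict_space borel {0..1})"
    by (intro measurable_restrict_space1 measurable_bump S)
  ultimately show ?thesis
    unfolding reward_class_def
    by (intro CollectI conjI ballI funcsetI) (simp_all only: thr le_max_iff_disj greaterThanLessThan_iff simp_thms)
qed

section \<open>Sums over the arms, regret and affinity of the pair\<close>

lemma sum_two_halves:
  fixes f :: "nat \<Rightarrow> real"
  shows "sum f {k<..k + 2 * q} = (\<Sum>i\<in>{k<..k + q}. f i + f (i + q))"
proof -
  have "{k<..k + 2 * q} = {k<..k + q} \<union> {k + q<..k + 2 * q}" by auto
  then have "sum f {k<..k + 2 * q} = sum f {k<..k + q} + sum f {k + q<..k + 2 * q}"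
    by (simp add: sum.union_disjoint ivl_disj_int)
  also have "sum f {k + q<..k + 2 * q} = (\<Sum>i\<in>{k<..k + q}. f (i + q))"
    by (rule sum.reindex_bij_witness[where i = "\<lambda>i. i + q" and j = "\<lambda>i. i - q"]) auto
  finally show ?thesis by (simp add: sum.distrib)
qed

text \<open>In units of arms the nodes are \<open>T - 2 * q\<close>, \<open>T\<close> and
  \<open>T + 2 * q\<close>, so the distance forms two tents of base \<open>2 * q\<close> and height
  \<open>q\<close>.\<close>

lemma sum_node_dist_tents:
  assumes "2 * q \<le> T"
  shows "(\<Sum>i\<in>{T - 2 * q<..T + 2 * q}. node_dist (real T) (2 * real q) (real i)) = 2 * real q ^ 2"
proof -
  let ?d = "\<lambda>i. node_dist (real T) (2 * real q) (real i)"
  have half: "sum ?d {k<..k + 2 * q} = real q ^ 2" if "k = T - 2 * q \<or> k = T" for k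
  proof -
    \<comment> \<open>Shifting by \<open>q\<close> pairs the ascending side of a tent with its descending side.\<close>
    have "?d i + ?d (i + q) = q" if "i \<in> {k<..k + q}" for i
      using that \<open>k = T - 2 * q \<or> k = T\<close> assms
      by (auto simp: node_dist_def min_def abs_if of_nat_diff)
    then have "sum ?d {k<..k + 2 * q} = (\<Sum>i\<in>{k<..k + q}. real q)"
      unfolding sum_two_halves by (rule sum.cong[OF refl])
    then show ?thesis by (simp add: power2_eq_square)
  qed
  have "{T - 2 * q<..T + 2 * q} = {T - 2 * q<..T} \<union> {T<..T + 2 * q}" using assms by auto
  then have "sum ?d {T - 2 * q<..T + 2 * q} = sum ?d {T - 2 * q<..T} + sum ?d {T<..T + 2 * q}"
    by (simp add: sum.union_disjoint ivl_disj_int)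
  also have "\<dots> = 2 * real q ^ 2"
    using half[of "T - 2 * q"] half[of T] assms by simp
  finally show ?thesis .
qed

lemma node_dist_tent_le:
  assumes "i \<in> {T - 2 * q<..T + 2 * q}"
  shows "node_dist (real T) (2 * real q) (real i) \<le> real q"
proof -
  have "real T - 2 * real q \<le> real i" "real i \<le> real T + 2 * real q" using assms by auto
  then show ?thesis by (auto simp: node_dist_def min_def abs_if)
qed

lemma bump_regret_dichotomy:
  fixes l :: real and N T q :: nat
  defines "a \<equiv> \<lambda>i. real i / real N" and "p \<equiv> real T / real N" and "w \<equiv> 2 * real q / real N"
  assumes l: "0 < l" and q: "2 * q \<le> T" "T + 2 * q \<le> N" "0 < N"
    and run: "proper_history N T (run f y T)"
  shows "2 * (l * real q ^ 2 / real N) \<le> regret N T a (bump l p w {..p}) f y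
    + regret N T a (bump l p w ({..p - w} \<union> {p<..p + w})) f y"
proof -
  let ?S = "{..p - w} \<union> {p<..p + w}"
  let ?B = "{T - 2 * q<..T + 2 * q}" and ?P = "pulled_arm f y ` {1..T}"
  let ?I = "{1..T}" and ?J = "{1..T - 2 * q} \<union> {T<..T + 2 * q}"
  let ?d = "\<lambda>i. node_dist p w (a i)"
  have p_w: "p - w = real (T - 2 * q) / N" "p + w = real (T + 2 * q) / N"
    using q by (simp_all add: p_def w_def of_nat_diff diff_divide_distrib add_divide_distrib)
  \<comment> \<open>Arms sitting exactly on a node belong to the block on their left, in agreement
    with the half-open intervals defining the functions.\<close>
  have I: "a i \<in> {..p} \<longleftrightarrow> i \<in> ?I" and J: "a i \<in> ?S \<longleftrightarrow> i \<in> ?J" if "i \<in> {1..N}" for i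
    using that q(3) unfolding p_w
    by (auto simp: a_def p_def divide_le_cancel divide_less_cancel simp del: of_nat_add of_nat_diff of_nat_mult)
  have pos: "1 / 2 \<le> bump l p w S x" if "x \<in> S" for S x
    using that l node_dist_nonneg[of p w x] by (simp add: bump_def)
  have neg: "bump l p w S x \<le> 1 / 2" if "x \<notin> S" for S x
    using that l node_dist_nonneg[of p w x] by (simp add: bump_def)
  have abs: "\<bar>bump l p w S x - 1 / 2\<bar> = l * node_dist p w x" for S x
    using l by (simp add: abs_bump)
  \<comment> \<open>The second function exchanges the \<open>2 * q\<close> arms up to
    \<open>T\<close> for the next \<open>2 * q\<close> arms, so both functions have exactly
    \<open>T\<close> good arms.\<close>
  have card_J: "card ?J = T"
    using q by (subst card_Un_disjoint) auto
  have flip: "i \<in> ?J \<longleftrightarrow> i \<notin> ?I" if "i \<in> ?B" for i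
    using that by auto
  have sub: "?I \<subseteq> {1..N}" "?J \<subseteq> {1..N}" "?B \<subseteq> {1..N}" "T \<le> N" using q by auto
  have "(\<Sum>i | i \<in> ?B \<and> (i \<in> ?I) \<noteq> (i \<in> ?P). l * ?d i) \<le> regret N T a (bump l p w {..p}) f y"
    unfolding abs[symmetric, of _ "{..p}"]
  proof (rule regret_ge_misclassified[OF run sub(4,1) _ _ _ sub(3)])
    show "1 / 2 \<le> bump l p w {..p} (a i)" if "i \<in> ?I" for i
      using that sub(1) I[of i] by (intro pos) blast
    show "bump l p w {..p} (a i) \<le> 1 / 2" if "i \<in> {1..N} - ?I" for i
      using that I[of i] by (intro neg) blast
  qed simp
  moreover have "(\<Sum>i | i \<in> ?B \<and> (i \<in> ?J) \<noteq> (i \<in> ?P). l * ?d i) \<le> regret N T a (bump l p w ?S) f y"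
    unfolding abs[symmetric, of _ ?S]
  proof (rule regret_ge_misclassified[OF run sub(4,2) card_J _ _ sub(3)])
    show "1 / 2 \<le> bump l p w ?S (a i)" if "i \<in> ?J" for i
      using that sub(2) J[of i] by (intro pos) blast
    show "bump l p w ?S (a i) \<le> 1 / 2" if "i \<in> {1..N} - ?J" for i
      using that J[of i] by (intro neg) blast
  qed
  \<comment> \<open>On \<open>?B\<close> the sets \<open>?I\<close> and \<open>?J\<close> are
    complementary, so each arm there is counted in exactly one of the two sums.\<close>
  moreover have "(\<Sum>i | i \<in> ?B \<and> (i \<in> ?I) \<noteq> (i \<in> ?P). l * ?d i)
      + (\<Sum>i | i \<in> ?B \<and> (i \<in> ?J) \<noteq> (i \<in> ?P). l * ?d i) = (\<Sum>i\<in>?B. l * ?d i)"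
    using flip by (simp only: sum.inter_filter finite_greaterThanAtMost sum.distrib[symmetric])
      (intro sum.cong, auto)
  moreover have "(\<Sum>i\<in>?B. l * ?d i) = l * (\<Sum>i\<in>?B. node_dist T (2 * real q) i) / N"
    using q(3) unfolding a_def p_def w_def
    by (simp add: node_dist_divide sum_distrib_left sum_divide_distrib)
  moreover have "\<dots> = 2 * (l * real q ^ 2 / real N)"
    using sum_node_dist_tents[OF q(1)] by simp
  ultimately show ?thesis by linarith
qed

text \<open>Off the block \<open>?B\<close> the two laws agree and the factor is 1. On it the
  parameters are symmetric about 1/2 and the squared factor is \<open>1 - 4 * (h i)\<^sup>2\<close>;
  the Weierstrass inequality bounds the product below by 1 minus the sum over the
  \<open>4 * q\<close> arms of the block.\<close>

lemma bump_affinity: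
  fixes l :: real and N T q :: nat
  defines "a \<equiv> \<lambda>i. real i / real N" and "p \<equiv> real T / real N" and "w \<equiv> 2 * real q / real N"
  assumes l: "0 < l" "l \<le> 1 / 2" and q: "2 * q \<le> T" "T + 2 * q \<le> N" "0 < N"
  shows "1 - 16 * real q ^ 3 * l\<^sup>2 / (real N)\<^sup>2 \<le> (\<Prod>i\<in>{1..N}. \<Sum>b\<in>UNIV.
      sqrt (pmf (bernoulli_pmf (bump l p w {..p} (a i))) b
          * pmf (bernoulli_pmf (bump l p w ({..p - w} \<union> {p<..p + w}) (a i))) b))\<^sup>2"
    (is "_ \<le> (\<Prod>i\<in>_. ?F i)\<^sup>2")
proof -
  let ?S = "{..p - w} \<union> {p<..p + w}"
  let ?B = "{T - 2 * q<..T + 2 * q}"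
  define h where "h i = l * node_dist p w (a i)" for i
  have h: "0 \<le> h i" for i using l node_dist_nonneg[of p w] by (simp add: h_def)
  have h_half: "h i \<le> 1 / 2" if "i \<in> {1..N}" for i
  proof -
    have "a i \<in> {0..1}" "p \<in> {0..1}" using that q by (auto simp: a_def p_def)
    then have "node_dist p w (a i) \<le> 1"
      using node_dist_le[of p p w "a i"] by (auto simp: abs_if split: if_splits)
    then show ?thesis
      using l node_dist_nonneg[of p w "a i"] mult_mono[of l "1/2" "node_dist p w (a i)" 1]
      by (simp add: h_def)
  qed
  have h_B: "h i \<le> l * (q / N)" if "i \<in> ?B" for i
    using node_dist_tent_le[OF that] l q(3) unfolding h_def a_def p_def w_def
    by (simp add: node_dist_divide divide_right_mono)
  have p_w: "p - w = real (T - 2 * q) / N" "p + w = real (T + 2 * q) / N"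
    using q by (simp_all add: p_def w_def of_nat_diff diff_divide_distrib add_divide_distrib)
  have on_B: "a i \<in> ?S \<longleftrightarrow> (a i \<in> {..p}) \<noteq> (i \<in> ?B)" if "i \<in> {1..N}" for i
    using that q unfolding p_w
    by (auto simp: a_def p_def divide_le_cancel divide_less_cancel simp del: of_nat_add of_nat_diff of_nat_mult)
  have F: "?F i = (if i \<in> ?B then sqrt (1 - 4 * (h i)\<^sup>2) else 1)" if i: "i \<in> {1..N}" for i
  proof -
    \<comment> \<open>The signed deviation from 1/2 under the first function; the second reverses it
      exactly on \<open>?B\<close>.\<close>
    define s where "s = (if a i \<in> {..p} then h i else - h i)"
    have b0: "bump l p w {..p} (a i) = 1 / 2 + s"
      by (simp add: bump_def s_def h_def)
    have b1: "bump l p w ?S (a i) = 1 / 2 + (if i \<in> ?B then - s else s)"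
      using on_B[OF i] by (simp add: bump_def s_def h_def)
    have s: "\<bar>s\<bar> \<le> 1 / 2" "s\<^sup>2 = (h i)\<^sup>2" using h[of i] h_half[OF i] by (auto simp: s_def)
    then have F: "?F i = sqrt ((1 / 2 + s) * (1 / 2 + (if i \<in> ?B then - s else s)))
        + sqrt ((1 - (1 / 2 + s)) * (1 - (1 / 2 + (if i \<in> ?B then - s else s))))"
      unfolding b0 b1 by (intro bernoulli_affinity) (auto simp: abs_le_iff)
    show ?thesis
    proof (cases "i \<in> ?B")
      case True
      have "1 - 4 * (h i)\<^sup>2 = 4 * (1 / 4 - s\<^sup>2)" using s by simp
      then have "sqrt (1 - 4 * (h i)\<^sup>2) = 2 * sqrt (1 / 4 - s\<^sup>2)"
        by (simp only: real_sqrt_mult real_sqrt_four)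
      then show ?thesis unfolding F using True by (simp add: algebra_simps power2_eq_square)
    next
      case False
      have "sqrt ((1 / 2 + s) * (1 / 2 + s)) = 1 / 2 + s" "sqrt ((1 / 2 - s) * (1 / 2 - s)) = 1 / 2 - s"
        using s(1) by (auto simp: abs_le_iff)
      then show ?thesis unfolding F if_not_P[OF False] by simp
    qed
  qed
  have B: "?B \<subseteq> {1..N}" using q by auto
  have small: "4 * (h i)\<^sup>2 \<in> {0..1}" if "i \<in> {1..N}" for i
    using power_mono[OF h_half[OF that] h, of 2] by (simp add: power2_eq_square)
  have "(\<Sum>i\<in>?B. 4 * (h i)\<^sup>2) \<le> (\<Sum>i\<in>?B. 4 * (l * (q / N))\<^sup>2)"
    using h h_B by (intro sum_mono mult_left_mono power_mono) auto
  also have "\<dots> = real (card ?B) * (4 * (l * (q / N))\<^sup>2)" by simp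
  also have "card ?B = 4 * q" using q(1) by simp
  also have "real (4 * q) * (4 * (l * (q / N))\<^sup>2) = 16 * real q ^ 3 * l\<^sup>2 / (real N)\<^sup>2"
    by (simp add: power2_eq_square power3_eq_cube)
  finally have "1 - 16 * real q ^ 3 * l\<^sup>2 / (real N)\<^sup>2 \<le> 1 - (\<Sum>i\<in>?B. 4 * (h i)\<^sup>2)" by simp
  also have "\<dots> \<le> (\<Prod>i\<in>?B. 1 - 4 * (h i)\<^sup>2)"
    by (rule Weierstrass_prod_ineq) (use small B in blast)
  also have "\<dots> = (\<Prod>i\<in>?B. sqrt (1 - 4 * (h i)\<^sup>2))\<^sup>2"
    unfolding prod_power_distrib using small B by (intro prod.cong refl) fastforce
  also have "(\<Prod>i\<in>?B. sqrt (1 - 4 * (h i)\<^sup>2)) = (\<Prod>i\<in>{1..N}. ?F i)"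
    using B F by (intro prod.mono_neutral_cong_left) auto
  finally show ?thesis .
qed

text \<open>By \<open>info\<close> the squared affinity is at least 0.4, so the two tails add up to
  at least 0.2. Both are at most the supremum, which is therefore at least 0.1.\<close>

lemma bump_lower_bound:
  fixes l :: real and N T q :: nat
  defines "a \<equiv> \<lambda>i. real i / real N" and "p \<equiv> real T / real N" and "w \<equiv> 2 * real q / real N"
  assumes L: "0 < l" "l \<le> 1 / 2" "l \<le> L" "6 / l \<le> Q"
    and q: "0 < q" "2 * q < T" "T + 2 * q \<le> N"
    and info: "16 * real q ^ 3 * l\<^sup>2 \<le> 0.6 * (real N)\<^sup>2"
    and r: "r \<le> l * real q ^ 2 / real N"
    and S: "S \<in> strategies N T"
  shows "ennreal 0.1 \<le> (SUP m \<in> reward_class p L Q. regret_tail N T a m S r)" (is "_ \<le> ?sup")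
proof -
  let ?m = "bump l p w {..p}" and ?m' = "bump l p w ({..p - w} \<union> {p<..p + w})"
  obtain U \<phi> where S_eq: "S = (U, \<phi>)" by fastforce
  have N: "0 < N" using q by simp
  have w: "0 < w" "w < p" "p + w \<le> 1"
    using q N by (simp_all add: w_def p_def divide_strict_right_mono add_divide_distrib[symmetric])
  have "{..p} \<inter> {0..1} = {0..p}" using w by auto
  then have m: "?m \<in> reward_class p L Q"
    using w L by (intro bump_in_reward_class) auto
  have "({..p - w} \<union> {p<..p + w}) \<inter> {0..1} = {0..p - w} \<union> {p<..p + w}" using w by auto
  moreover have "measure lborel ({0..p - w} \<union> {p<..p + w}) = p"
    using w by (subst measure_Union) auto
  ultimately have m': "?m' \<in> reward_class p L Q"
    using w L by (intro bump_in_reward_class) auto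
  have "r \<le> regret N T a ?m (\<phi> u) y \<or> r \<le> regret N T a ?m' (\<phi> u) y" if "u \<in> space U" for u y
    using bump_regret_dichotomy[of l q T N "\<phi> u" y] strategies_proper_history[of U \<phi> N T u y] that S r q L N
    unfolding a_def p_def w_def S_eq by fastforce
  moreover have "0.2 \<le> (\<Prod>i\<in>{1..N}. \<Sum>b\<in>UNIV.
      sqrt (pmf (bernoulli_pmf (?m (a i))) b * pmf (bernoulli_pmf (?m' (a i))) b))\<^sup>2 / 2"
  proof -
    have "16 * real q ^ 3 * l\<^sup>2 / (real N)\<^sup>2 \<le> 0.6" using info N by (simp add: divide_le_eq)
    then show ?thesis
      using bump_affinity[of l q T N] L q N unfolding a_def p_def w_def by linarith
  qed
  ultimately have "ennreal 0.2 \<le> regret_tail N T a ?m S r + regret_tail N T a ?m' S r"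
    unfolding S_eq using S by (intro bandit_two_point_bound) (auto simp: S_eq)
  also have "\<dots> \<le> ?sup + ?sup" using m m' by (intro add_mono SUP_upper)
  finally have "ennreal 0.2 \<le> ?sup + ?sup" .
  moreover have "ennreal 0.1 \<le> x" if "ennreal 0.2 \<le> x + x" for x
    using that by (cases x) (simp_all add: ennreal_plus[symmetric] del: ennreal_plus)
  ultimately show ?thesis by blast
qed

section \<open>Choice of the constant and of the scales\<close>

theorem corollary2:
  fixes L :: real
  assumes "L > 0"
  shows "\<exists>C::real. \<forall>(Q::real) (N::nat) (T::nat) (\<alpha>::real).
    Q > max (6 / L) 12 \<longrightarrow>
    real N > exp (3 * C) \<longrightarrow>
    2 / 3 + C / ln (real N) < \<alpha> \<longrightarrow> \<alpha> \<le> 1 \<longrightarrow>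
    real T = 0.5 * real N powr \<alpha> \<longrightarrow>
    (INF S \<in> strategies N T.
       SUP m \<in> reward_class (0.5 * real N powr (\<alpha> - 1)) L Q.
         regret_tail N T (\<lambda>i. real i / real N) m S (0.01 * real T powr (1 / (3 * \<alpha>))))
      \<ge> ennreal 0.1"
proof -
  \<comment> \<open>With this slope \<open>6 / l\<close> equals \<open>max (6 / L) 12\<close>. The
    constant will be \<open>C = ln (10 / l)\<close>.\<close>
  define l where "l = min L (1 / 2)"
  have l: "0 < l" "l \<le> 1 / 2" "l \<le> L" using assms by (auto simp: l_def)
  have "ennreal 0.1 \<le> (INF S \<in> strategies N T.
       SUP m \<in> reward_class (0.5 * real N powr (\<alpha> - 1)) L Q.
         regret_tail N T (\<lambda>i. real i / real N) m S (0.01 * real T powr (1 / (3 * \<alpha>))))"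
    if Q: "Q > max (6 / L) 12" and N_gt: "real N > exp (3 * ln (10 / l))"
      and \<alpha>: "2 / 3 + ln (10 / l) / ln (real N) < \<alpha>" "\<alpha> \<le> 1"
      and T: "real T = 0.5 * real N powr \<alpha>"
    for Q :: real and N T :: nat and \<alpha> :: real
  proof (rule INF_greatest)
    fix S assume S: "S \<in> strategies N T"
    define n where "n = real N"
    \<comment> \<open>This scale balances the two requirements:
      \<open>s ^ 3 * l\<^sup>2 / n\<^sup>2\<close> equals \<open>sqrt l\<close>, hence is at most 1,
      while \<open>l * (s / 10)\<^sup>2 / n\<close> is exactly \<open>0.01 * n powr (1 / 3)\<close>.
      Rounding \<open>s / 10\<close> up to \<open>q\<close> keeps the regret bound.\<close>
    define s where "s = n powr (2 / 3) / sqrt l"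
    define q where "q = nat \<lceil>s / 10\<rceil>"
    have C: "10 / l \<ge> 20" "ln (10 / l) > 0" using l by (auto simp: field_simps)
    have n: "n > 0" "ln n > 3 * ln (10 / l)"
      using N_gt ln_less_cancel_iff[of "exp (3 * ln (10 / l))" n] exp_gt_zero[of "3 * ln (10 / l)"]
      by (auto simp: n_def simp del: exp_gt_zero ln_less_cancel_iff intro: order_less_trans)
    have n1: "n \<ge> 1" using n C(2) ln_gt_zero_imp_gt_one[of n] by linarith
    have "\<alpha> > 2 / 3" using \<alpha>(1) C(2) n by (smt (verit) divide_pos_pos n_def)
    have sqrt_l: "0 < sqrt l" "l \<le> sqrt l" "sqrt l \<le> 1"
      using l by (auto simp: real_le_rsqrt power2_eq_square mult_left_le_one_le)
    have n23: "n powr (2 / 3) \<ge> 400"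
    proof -
      have "exp (2 * ln (10 / l)) \<le> n powr (2 / 3)" using n by (simp add: powr_def)
      moreover have "exp (2 * ln (10 / l)) = (10 / l)\<^sup>2"
        using l by (simp add: exp_double)
      moreover have "(10 / l)\<^sup>2 \<ge> 20\<^sup>2" using C by (intro power_mono) auto
      ultimately show ?thesis by simp
    qed
    have s: "n powr (2 / 3) \<le> s" "s \<le> n powr (2 / 3) / l"
      using sqrt_l l by (auto simp: s_def divide_simps mult_left_le intro: mult_left_mono)
    \<comment> \<open>Multiplying the condition on \<alpha> by \<open>ln n\<close> and
      exponentiating gives \<open>n powr \<alpha> > 10 / l * n powr (2 / 3)\<close>, which is at
      least \<open>10 * s\<close>; \<open>T\<close> is half of the left side.\<close>
    have T_gt: "5 * s < T"
    proof -
      have "ln (10 / l) + 2 / 3 * ln n < \<alpha> * ln n"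
      proof -
      have "0 < ln n" using C(2) n(2) by linarith
      then show ?thesis
        using mult_strict_right_mono[OF \<alpha>(1), of "ln n"] n1
        by (simp add: n_def[symmetric] distrib_right)
    qed
      then have "exp (ln (10 / l) + 2 / 3 * ln n) < n powr \<alpha>" using n(1) by (simp add: powr_def)
      then have "10 / l * n powr (2 / 3) < n powr \<alpha>"
        using l n(1) by (simp add: exp_add powr_def)
      then show ?thesis using T s(2) by (simp add: n_def[symmetric])
    qed
    have T_le: "2 * real T \<le> n"
      using T \<alpha>(2) n1 powr_mono[of \<alpha> 1 n] by (simp add: n_def[symmetric])
    \<comment> \<open>As \<open>s\<close> is at least 400, rounding adds at most 1, which is less
      than \<open>s / 10\<close>.\<close>
    have q: "s / 10 \<le> q" "q \<le> s / 5" "0 < q"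
      using n23 s(1) by (auto simp: q_def) linarith+
    have "2 * q < T" "T + 2 * q \<le> N" using q(2) T_gt T_le n23 s(1) unfolding n_def by linarith+
    have p: "0.5 * real N powr (\<alpha> - 1) = real T / real N"
      unfolding T using n(1) by (simp add: n_def powr_diff)
    have s3: "s ^ 3 * l\<^sup>2 \<le> n\<^sup>2"
    proof -
      have "(n powr (2 / 3)) ^ 3 = n\<^sup>2"
        using n(1) by (simp add: powr_power)
      moreover have "sqrt l ^ 3 = l * sqrt l" using l by (simp add: power3_eq_cube)
      ultimately have "s ^ 3 * l\<^sup>2 = n\<^sup>2 * (l / sqrt l)"
        using l by (simp add: s_def power_divide power2_eq_square)
      also have "l / sqrt l = sqrt l" using l by (simp add: real_div_sqrt)
      finally show ?thesis using sqrt_l by (simp add: mult_left_le)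
    qed
    have info: "16 * real q ^ 3 * l\<^sup>2 \<le> 0.6 * (real N)\<^sup>2"
    proof -
      have "real q ^ 3 \<le> (s / 5) ^ 3" using q by (intro power_mono) auto
      then have "real q ^ 3 * l\<^sup>2 \<le> (s / 5) ^ 3 * l\<^sup>2" by (intro mult_right_mono) auto
      also have "\<dots> \<le> n\<^sup>2 / 125" using s3 by (simp add: power_divide)
      finally have "125 * (real q ^ 3 * l\<^sup>2) \<le> n\<^sup>2" by simp
      moreover have "0 \<le> n\<^sup>2" by simp
      ultimately have "16 * (real q ^ 3 * l\<^sup>2) \<le> 0.6 * n\<^sup>2" by linarith
      then show ?thesis by (simp add: n_def mult.assoc)
    qed
    have r: "0.01 * real T powr (1 / (3 * \<alpha>)) \<le> l * real q ^ 2 / real N"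
    proof -
      \<comment> \<open>Dropping the factor 0.5 in \<open>T\<close> makes the exponents cancel to
        1/3, whatever \<alpha> is.\<close>
      have "real T powr (1 / (3 * \<alpha>)) \<le> (n powr \<alpha>) powr (1 / (3 * \<alpha>))"
        using T \<open>\<alpha> > 2 / 3\<close> by (intro powr_mono2) (auto simp: n_def)
      also have "\<dots> = n powr (1 / 3)" using \<open>\<alpha> > 2 / 3\<close> by (simp add: powr_powr)
      finally have "0.01 * real T powr (1 / (3 * \<alpha>)) \<le> 0.01 * n powr (1 / 3)" by simp
      also have "\<dots> = l * (s / 10)\<^sup>2 / n"
      proof -
        have "(n powr (2 / 3))\<^sup>2 = n * n powr (1 / 3)"
          using n(1) by (simp add: powr_power powr_mult_base)
        then show ?thesis using l n(1) by (simp add: s_def power_divide)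
      qed
      also have "\<dots> \<le> l * real q ^ 2 / n"
        using q l n(1) s(1) n23 by (intro divide_right_mono mult_left_mono power_mono) auto
      finally show ?thesis by (simp add: n_def)
    qed
    have "6 / l \<le> Q" using Q assms by (auto simp: l_def min_def)
    show "ennreal 0.1 \<le> (SUP m \<in> reward_class (0.5 * real N powr (\<alpha> - 1)) L Q.
         regret_tail N T (\<lambda>i. real i / real N) m S (0.01 * real T powr (1 / (3 * \<alpha>))))"
      unfolding p by (rule bump_lower_bound[of l L Q q]) fact+
  qed
  then show ?thesis by blast
qed

end
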